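(* Let $T$ be a tree of order $n\ge 2$. Then every nonzero subtree root $z\in\mathbb{C}$ of $T$ satisfies $$|z|>\sqrt[n-1]{n-1}-1.$$
   Context: The order of a tree is its number of vertices. A subtree of a tree $T$ is a nonempty connected subgraph of $T$ (equivalently, a nonempty vertex set inducing a connected subgraph). For a tree $T$ of order $n$, let $s_k(T)$ denote the number of subtrees of $T$ with exactly $k$ vertices. The subtree polynomial of $T$ is $\Phi_T(z)=\sum_{k=1}^{n}s_k(T)z^k$. The subtree roots of $T$ are the zeros in $\mathbb{C}$ of $\Phi_T(z)$. *)

theory Defs
  imports Complex_Main "HOL-Computational_Algebra.Polynomial" "Graph_Theory.Graph_Theory"
begin

text \<open>
  A finite simple graph is a digraph satisfying the locale predicate \<^const>\<open>graph\<close>: finite,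
  loop-free, without parallel arcs and symmetric, each undirected edge being a pair of opposite arcs.
  The constant \<^const>\<open>tree\<close> of the graph library cannot be used for such graphs: it forbids all
  directed cycles, hence also the closed walk of length 2 that runs back and forth along an edge.
  In a simple graph the cycles in the undirected sense are exactly the directed cycles of length
  at least 3. The library's notion of connectedness excludes the empty graph; its name is
  qualified to avoid the topological one.
\<close>

definition undirected_tree :: "('a, 'b) pre_digraph \<Rightarrow> bool" where
  "undirected_tree T \<longleftrightarrow>
     graph T \<and> Digraph_Component.connected T \<and>
     \<not> (\<exists>p. pre_digraph.cycle T p \<and> length p \<ge> 3)"

text \<open>
  The condition \<^term>\<open>graph H\<close> says that a subgraph contains both or none of the two arcs
  representing an edge.
\<close>

definition subtrees :: "('a, 'b) pre_digraph \<Rightarrow> ('a, 'b) pre_digraph set" where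
  "subtrees T = {H. subgraph H T \<and> graph H \<and> Digraph_Component.connected H}"

definition num_subtrees :: "('a, 'b) pre_digraph \<Rightarrow> nat \<Rightarrow> nat" where
  "num_subtrees T k = card {H \<in> subtrees T. card (verts H) = k}"

definition subtree_poly :: "('a, 'b) pre_digraph \<Rightarrow> complex poly" where
  "subtree_poly T = (\<Sum>k = 1..card (verts T). monom (of_nat (num_subtrees T k)) k)"

definition subtree_roots :: "('a, 'b) pre_digraph \<Rightarrow> complex set" where
  "subtree_roots T = {z. poly (subtree_poly T) z = 0}"

end

theory Submission
  imports Defs
begin

text \<open>
  The idea is that, apart from single vertices, a tree of order \<open>n\<close> has at most as many subtrees
  of each order as the star of order \<open>n\<close>, whose subtree polynomial is
  \<open>z ((n - 1) + (1 + z)^(n - 1))\<close>.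

  Root the tree \<open>T\<close> at a vertex \<open>v\<close>. In a subtree \<open>H\<close> of order \<open>k \<ge> 2\<close> every vertex but the one
  nearest to \<open>v\<close> is joined in \<open>H\<close> to its parent. Deleting that top vertex leaves a set of
  \<open>k - 1\<close> vertices different from \<open>v\<close>, from which \<open>H\<close> can be recovered: its edges join the vertices
  of the set to their parents. Hence \<open>s\<^sub>k(T)\<close> is at most the binomial coefficient of \<open>n - 1\<close> over
  \<open>k - 1\<close> (\<open>num_subtrees_le\<close>), while \<open>s\<^sub>1(T) = n\<close> (\<open>num_subtrees_1\<close>).

  If \<open>z \<noteq> 0\<close> is a subtree root, then, after division by \<open>z\<close>, the constant term \<open>n\<close> is balanced by
  the others, whose sum has absolute value at most \<open>(1 + |z|)^(n - 1) - 1\<close> by the binomial theorem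
  (\<open>subtree_polynomial_root_bound\<close>). So \<open>(1 + |z|)^(n - 1) \<ge> n + 1 > n - 1\<close>, and taking roots
  gives the claim.
\<close>

section \<open>Walks that avoid a vertex\<close>

lemma (in wf_digraph) reachable_del_vertI:
  assumes "awalk u p w" and "x \<notin> set (awalk_verts u p)"
  shows "u \<rightarrow>\<^sup>*\<^bsub>del_vert x\<^esub> w"
  using assms
proof (induction p arbitrary: u)
  case Nil
  interpret D: wf_digraph "del_vert x" by (rule wf_digraph_del_vert)
  from Nil show ?case
    by (auto simp: awalk_Nil_iff del_vert_simps intro!: D.reachable_refl)
next
  case (Cons e es)
  interpret D: wf_digraph "del_vert x" by (rule wf_digraph_del_vert)
  from Cons.prems have e: "e \<in> arcs G" "u = tail G e" "awalk (head G e) es w"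
    by (auto simp: awalk_Cons_iff)
  then have "head G e \<noteq> x"
    using Cons.prems(2) hd_in_awalk_verts(1)[OF e(3)] by auto
  with e Cons.prems(2) have "u \<rightarrow>\<^bsub>del_vert x\<^esub> head G e"
    by (auto simp: arcs_ends_conv del_vert_simps image_iff)
  with Cons e show ?case
    by (auto intro: D.adj_reachable_trans)
qed

lemma (in graph) reachable_del_vert_sym:
  assumes "u \<rightarrow>\<^sup>*\<^bsub>del_vert x\<^esub> w"
  shows "w \<rightarrow>\<^sup>*\<^bsub>del_vert x\<^esub> u"
proof (rule symmetric_reachable[OF _ assms])
  show "symmetric (del_vert x)"
    using sym_arcs unfolding symmetric_conv by (fastforce simp: del_vert_simps)
qed

lemma (in sym_digraph) reachable_if_connected:
  assumes "Digraph_Component.connected G" and "u \<in> verts G" and "w \<in> verts G"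
  shows "u \<rightarrow>\<^sup>* w"
  using assms reachable_mk_symmetric_eq[OF sym_arcs]
  by (auto simp: Digraph_Component.connected_def)

section \<open>Parents in a rooted tree\<close>

locale rooted_tree = graph T for T :: "('a, 'b) pre_digraph" +
  fixes v :: 'a
  assumes undirected_tree: "undirected_tree T"
    and root_in_verts: "v \<in> verts T"
begin

lemma reachable_in_tree:
  assumes "u \<in> verts T" and "w \<in> verts T"
  shows "u \<rightarrow>\<^sup>*\<^bsub>T\<^esub> w"
  using undirected_tree assms by (auto simp: undirected_tree_def intro: reachable_if_connected)

text \<open>
  A path from \<open>y\<close> to \<open>z\<close> that avoids \<open>x\<close> closes up through \<open>x\<close> to a cycle, and the length of this
  cycle is at least 3 as soon as \<open>y \<noteq> z\<close>. This is the only place where acyclicity enters.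
\<close>

lemma neighbours_separated:
  assumes xy: "x \<rightarrow>\<^bsub>T\<^esub> y" and xz: "x \<rightarrow>\<^bsub>T\<^esub> z" and yz: "y \<rightarrow>\<^sup>*\<^bsub>del_vert x\<^esub> z"
  shows "y = z"
proof (rule ccontr)
  assume "y \<noteq> z"
  interpret D: wf_digraph "del_vert x" by (rule wf_digraph_del_vert)
  from yz obtain p where p: "D.apath y p z" by (auto simp: D.reachable_apath)
  have "x \<notin> set (D.awalk_verts y p)"
    using p unfolding D.apath_def D.awalk_conv by (auto simp: del_vert_simps)
  moreover have pT: "apath y p z"
    by (rule subgraph_apath_imp_apath[OF p subgraph_del_vert])
  moreover have "D.awalk_verts y p = awalk_verts y p"
    by (rule fun_cong[OF fun_cong[OF compatible_awalk_verts]])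
      (simp add: compatible_def del_vert_simps)
  ultimately have x: "x \<notin> set (awalk_verts y p)" by simp
  from xy obtain e where e: "e \<in> arcs T" "tail T e = x" "head T e = y" by auto
  from graph_symmetric[OF xz] obtain f where f: "f \<in> arcs T" "tail T f = z" "head T f = x" by auto
  have walk: "awalk y (p @ [f]) x"
    using pT f by (auto simp: apath_def awalk_simps)
  have "awalk x (e # p @ [f]) x"
    using walk e by (simp add: awalk_Cons_iff del: awalk_append_iff)
  moreover have "distinct (awalk_verts y (p @ [f]))"
    using pT x f by (subst awalk_verts_append[OF walk]) (auto simp: apath_def)
  ultimately have "cycle (e # p @ [f])"
    using e by (auto simp: cycle_def)
  moreover have "p \<noteq> []"
    using pT \<open>y \<noteq> z\<close> by (auto simp: apath_Nil_iff)
  then have "length (e # p @ [f]) \<ge> 3" by (cases p) auto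
  ultimately show False
    using undirected_tree unfolding undirected_tree_def by blast
qed

text \<open>
  The parent of \<open>x\<close> is the second vertex on the path from \<open>x\<close> to the root. Describing it through
  reachability in \<open>T - x\<close> means that any walk from \<open>x\<close> to the root that does not return to \<open>x\<close>
  witnesses it, so that walks can be concatenated freely.
\<close>

definition parent :: "'a \<Rightarrow> 'a \<Rightarrow> bool" where
  "parent x y \<longleftrightarrow> x \<rightarrow>\<^bsub>T\<^esub> y \<and> y \<rightarrow>\<^sup>*\<^bsub>del_vert x\<^esub> v"

lemma parent_unique:
  assumes "parent x y" and "parent x z"
  shows "y = z"
proof -
  interpret D: wf_digraph "del_vert x" by (rule wf_digraph_del_vert)
  show ?thesis
    using assms unfolding parent_def
    by (meson D.reachable_trans reachable_del_vert_sym neighbours_separated)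
qed

lemma root_no_parent: "\<not> parent v y"
proof -
  interpret D: wf_digraph "del_vert v" by (rule wf_digraph_del_vert)
  show ?thesis
    unfolding parent_def using D.reachable_in_verts(2)[of y v] by (auto simp: del_vert_simps)
qed

lemma parent_if_path:
  assumes "apath x (e # p) v"
  shows "parent x (head T e)"
proof -
  have e: "e \<in> arcs T" "tail T e = x" and p: "awalk (head T e) p v" "x \<notin> set (awalk_verts (head T e) p)"
    using assms by (auto simp: apath_Cons_iff intro: awalkI_apath)
  have "x \<rightarrow>\<^bsub>T\<^esub> head T e" using in_arcs_imp_in_arcs_ends[OF e(1)] e(2) by simp
  then show ?thesis using p by (auto simp: parent_def intro: reachable_del_vertI)
qed

lemma adjacent_parent:
  assumes "x \<rightarrow>\<^bsub>T\<^esub> y"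
  shows "parent x y \<or> parent y x"
proof -
  \<comment> \<open>The path from \<open>y\<close> to the root either avoids \<open>x\<close>, or its part after \<open>x\<close> avoids \<open>y\<close>.\<close>
  have "y \<rightarrow>\<^sup>*\<^bsub>T\<^esub> v"
    using assms by (intro reachable_in_tree root_in_verts adj_in_verts)
  then obtain q where q: "apath y q v" by (auto simp: reachable_apath)
  show ?thesis
  proof (cases "x \<in> set (awalk_verts y q)")
    case False
    then show ?thesis
      using assms q by (auto simp: parent_def apath_def intro: reachable_del_vertI)
  next
    case True
    then obtain q1 q2 where q12: "q = q1 @ q2" "awalk y q1 x" "awalk x q2 v"
      using q awalk_decomp unfolding apath_def by blast
    have "x \<noteq> y" using assms adj_not_same by blast
    have "y \<in> set (awalk_verts y q1)" using q12 hd_in_awalk_verts by blast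
    then have "y \<notin> set (tl (awalk_verts x q2))"
      using q q12 by (auto simp: apath_append_iff)
    moreover have "awalk_verts x q2 = x # tl (awalk_verts x q2)"
      using q12(3) by (metis awalk_verts_non_Nil awhd_of_awalk list.collapse)
    ultimately have "y \<notin> set (awalk_verts x q2)"
      using \<open>x \<noteq> y\<close> by (metis set_ConsD)
    then show ?thesis
      using q12(3) graph_symmetric[OF assms] by (auto simp: parent_def intro: reachable_del_vertI)
  qed
qed

section \<open>Encoding a subtree by its vertices below the top\<close>

definition lower_verts :: "('a, 'b) pre_digraph \<Rightarrow> 'a set" where
  "lower_verts H = {x. \<exists>y. x \<rightarrow>\<^bsub>H\<^esub> y \<and> parent x y}"

text \<open>
  Every edge of \<open>T\<close> joins some vertex to its parent. The lower end of an edge of \<open>H\<close> belongs to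
  \<^term>\<open>lower_verts H\<close>; conversely, by uniqueness of parents, the edge that makes \<open>x\<close> a member of
  \<^term>\<open>lower_verts H\<close> is the edge from \<open>x\<close> to its parent.
\<close>

lemma arcs_ends_eq_lower_verts:
  assumes "H \<in> subtrees T"
  shows "arcs_ends H =
    {(x, y). x \<in> lower_verts H \<and> parent x y \<or> y \<in> lower_verts H \<and> parent y x}"
proof -
  have H: "graph H" "subgraph H T" using assms by (auto simp: subtrees_def)
  interpret H: graph H by fact
  have "arcs_ends H \<subseteq> arcs_ends T" by (rule arcs_ends_mono) fact
  then show ?thesis
    using adjacent_parent H.graph_symmetric parent_unique
    unfolding lower_verts_def by blast
qed

lemma arcs_eq_lower_verts:
  assumes "H \<in> subtrees T"
  shows "arcs H = {e \<in> arcs T. arc_to_ends T e \<in> arcs_ends H}"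
proof -
  have sub: "subgraph H T" using assms by (auto simp: subtrees_def)
  then have "arc_to_ends H = arc_to_ends T"
    by (auto simp: subgraph_def compatible_def arc_to_ends_def fun_eq_iff)
  then show ?thesis
    using sub no_multi_arcs unfolding arcs_ends_def by (auto simp: subgraph_def)
qed

lemma verts_eq_Domain_arcs_ends:
  assumes "H \<in> subtrees T" and "card (verts H) \<ge> 2"
  shows "verts H = Domain (arcs_ends H)"
proof
  have "graph H" and conn: "Digraph_Component.connected H"
    using assms by (auto simp: subtrees_def)
  interpret H: graph H by fact
  show "Domain (arcs_ends H) \<subseteq> verts H"
    using H.adj_in_verts by blast
  show "verts H \<subseteq> Domain (arcs_ends H)"
  proof
    fix x assume x: "x \<in> verts H"
    have "verts H \<noteq> {x}" using assms(2) by auto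
    with x obtain y where "y \<in> verts H" "y \<noteq> x" by auto
    then have "x \<rightarrow>\<^sup>*\<^bsub>H\<^esub> y" using x conn H.reachable_if_connected by blast
    then show "x \<in> Domain (arcs_ends H)"
      by (rule H.converse_reachable_cases) (use \<open>y \<noteq> x\<close> in auto)
  qed
qed

text \<open>
  Subtrees of order 1 must be excluded: they have no edges, so all of them are mapped to the empty
  set.
\<close>

lemma inj_on_lower_verts:
  "inj_on lower_verts {H \<in> subtrees T. card (verts H) \<ge> 2}"
proof (rule inj_onI, clarify)
  fix H K assume HK: "H \<in> subtrees T" "card (verts H) \<ge> 2" "K \<in> subtrees T" "card (verts K) \<ge> 2"
    and eq: "lower_verts H = lower_verts K"
  have ends: "arcs_ends H = arcs_ends K"
    using HK eq by (simp add: arcs_ends_eq_lower_verts)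
  show "H = K"
  proof (rule pre_digraph.equality)
    show "verts H = verts K" using verts_eq_Domain_arcs_ends HK ends by metis
    show "arcs H = arcs K" using arcs_eq_lower_verts HK ends by metis
    show "tail H = tail K" "head H = head K"
      using HK by (auto simp: subtrees_def subgraph_def compatible_def)
  qed simp
qed

text \<open>
  A shortest path from the set \<open>U\<close> to the root meets \<open>U\<close> only in its starting point.
\<close>

lemma ex_top_vertex:
  assumes "U \<subseteq> verts T" and "U \<noteq> {}"
  obtains t q where "t \<in> U" and "apath t q v" and "set (awalk_verts t q) \<inter> U = {t}"
proof -
  let ?P = "\<lambda>(t, q). t \<in> U \<and> apath t q v"
  obtain u where u: "u \<in> U" using assms by auto
  then have "u \<rightarrow>\<^sup>*\<^bsub>T\<^esub> v" using assms by (intro reachable_in_tree root_in_verts) auto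
  with u obtain p where "?P (u, p)" by (auto simp: reachable_apath)
  from ex_has_least_nat[of ?P, OF this, of "\<lambda>(t, q). length q"]
  obtain t q where tq: "t \<in> U" "apath t q v"
    and least: "\<And>t' q'. t' \<in> U \<Longrightarrow> apath t' q' v \<Longrightarrow> length q \<le> length q'"
    by auto
  have "w = t" if w: "w \<in> set (awalk_verts t q)" "w \<in> U" for w
  proof -
    obtain q1 q2 where q12: "q = q1 @ q2" "awalk t q1 w" "awalk w q2 v"
      using w tq awalk_decomp unfolding apath_def by blast
    have "apath w q2 v"
      using tq q12 by (auto simp: apath_append_iff)
    then have "q1 = []" using least[OF w(2)] q12(1) by fastforce
    then show ?thesis using q12(2) by (auto simp: awalk_Nil_iff)
  qed
  moreover have "t \<in> set (awalk_verts t q)" using tq hd_in_awalk_verts by blast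
  ultimately show thesis using that tq by blast
qed

text \<open>
  The vertex \<open>t\<close> is the top of \<open>H\<close>: a path from \<open>t\<close> to the root leaves \<open>H\<close> at once, so the parent of
  \<open>t\<close>, if there is one, lies outside \<open>H\<close>. From any other vertex \<open>x\<close> of \<open>H\<close>, follow a path in \<open>H\<close> to
  \<open>t\<close> and then the path from \<open>t\<close> to the root. After the first step this walk avoids \<open>x\<close>, so the first
  step goes to the parent of \<open>x\<close>, along an edge of \<open>H\<close>.
\<close>

lemma lower_verts_eq:
  assumes "H \<in> subtrees T"
  obtains t where "t \<in> verts H" and "lower_verts H = verts H - {t}"
proof -
  have "graph H" and conn: "Digraph_Component.connected H" and sub: "subgraph H T"
    using assms by (auto simp: subtrees_def)
  interpret H: graph H by fact
  have ne: "verts H \<noteq> {}" "verts H \<subseteq> verts T"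
    using conn sub
    by (auto simp: Digraph_Component.connected_def strongly_connected_def subgraph_def)
  from ex_top_vertex[OF ne(2,1)] obtain t q
    where t: "t \<in> verts H" and q: "apath t q v" and q_meets: "set (awalk_verts t q) \<inter> verts H = {t}"
    by blast
  have "parent x y \<Longrightarrow> x \<rightarrow>\<^bsub>H\<^esub> y \<Longrightarrow> x \<in> verts H - {t}" for x y
  proof -
    assume xy: "parent x y" "x \<rightarrow>\<^bsub>H\<^esub> y"
    have "x \<noteq> t"
    proof
      assume [simp]: "x = t"
      show False
      proof (cases q)
        case Nil
        then show False using q xy root_no_parent by (auto simp: apath_Nil_iff)
      next
        case (Cons e es)
        then have "y = head T e"
          using parent_unique[OF xy(1)] parent_if_path q by auto
        then have "y \<in> set (awalk_verts (head T e) es)"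
          using q hd_in_awalk_verts Cons by (auto simp: apath_Cons_iff)
        moreover have "t \<notin> set (awalk_verts (head T e) es)"
          using q Cons by (auto simp: apath_Cons_iff)
        ultimately show False
          using q_meets H.adj_in_verts(2)[OF xy(2)] Cons by auto
      qed
    qed
    then show ?thesis using H.adj_in_verts(1)[OF xy(2)] by simp
  qed
  moreover have "\<exists>y. x \<rightarrow>\<^bsub>H\<^esub> y \<and> parent x y" if x: "x \<in> verts H" "x \<noteq> t" for x
  proof -
    have "x \<rightarrow>\<^sup>*\<^bsub>H\<^esub> t" using x t conn H.reachable_if_connected by blast
    then obtain p where p: "H.apath x p t" by (auto simp: H.reachable_apath)
    with x obtain e es where [simp]: "p = e # es"
      by (cases p) (auto simp: H.apath_Nil_iff)
    have e: "e \<in> arcs H" "tail H e = x" and ends: "tail H = tail T" "head H = head T"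
      using p sub by (auto simp: H.apath_Cons_iff subgraph_def compatible_def)
    have pT: "apath x (e # es) t" using subgraph_apath_imp_apath[OF _ sub] p by simp
    have "x \<notin> set (awalk_verts t q)" using x q_meets by auto
    then have "t \<rightarrow>\<^sup>*\<^bsub>del_vert x\<^esub> v"
      using q by (auto simp: apath_def intro: reachable_del_vertI)
    moreover have "awalk (head T e) es t" "x \<notin> set (awalk_verts (head T e) es)"
      using pT by (auto simp: apath_Cons_iff intro: awalkI_apath)
    then have "head T e \<rightarrow>\<^sup>*\<^bsub>del_vert x\<^esub> t"
      by (rule reachable_del_vertI)
    ultimately have "head T e \<rightarrow>\<^sup>*\<^bsub>del_vert x\<^esub> v"
      using wf_digraph.reachable_trans[OF wf_digraph_del_vert] by blast
    moreover have "x \<rightarrow>\<^bsub>H\<^esub> head T e"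
      using H.in_arcs_imp_in_arcs_ends[OF e(1)] e(2) ends by simp
    ultimately show ?thesis
      using arcs_ends_mono[OF sub] unfolding parent_def by blast
  qed
  ultimately have "lower_verts H = verts H - {t}"
    unfolding lower_verts_def by blast
  with t show thesis by (rule that)
qed

lemma num_subtrees_le:
  assumes "k \<ge> 2"
  shows "num_subtrees T k \<le> (card (verts T) - 1) choose (k - 1)"
proof -
  let ?A = "{H \<in> subtrees T. card (verts H) = k}"
  let ?B = "{S. S \<subseteq> verts T - {v} \<and> card S = k - 1}"
  have "card ?A \<le> card ?B"
  proof (rule card_inj_on_le)
    show "inj_on lower_verts ?A"
      by (rule inj_on_subset[OF inj_on_lower_verts]) (use assms in auto)
    show "lower_verts ` ?A \<subseteq> ?B"
    proof clarify
      fix H assume H: "H \<in> subtrees T" "k = card (verts H)"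
      obtain t where t: "t \<in> verts H" "lower_verts H = verts H - {t}"
        using lower_verts_eq[OF H(1)] .
      have "v \<notin> lower_verts H" using root_no_parent by (auto simp: lower_verts_def)
      moreover have "verts H \<subseteq> verts T" using H by (auto simp: subtrees_def subgraph_def)
      ultimately show "lower_verts H \<subseteq> verts T - {v} \<and> card (lower_verts H) = card (verts H) - 1"
        using t by auto
    qed
    show "finite ?B" by simp
  qed
  also have "card ?B = (card (verts T) - 1) choose (k - 1)"
    using root_in_verts by (simp add: n_subsets)
  finally show ?thesis by (simp add: num_subtrees_def)
qed

end

section \<open>From the coefficient bounds to the roots\<close>

lemma num_subtrees_1:
  assumes "graph T"
  shows "num_subtrees T 1 = card (verts T)"
proof -
  interpret graph T by fact
  define sg where "sg = (\<lambda>x. \<lparr>verts = {x}, arcs = {}, tail = tail T, head = head T\<rparr>)"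
  have "sg x \<in> {H \<in> subtrees T. card (verts H) = 1}" if x: "x \<in> verts T" for x
  proof -
    have g: "graph (sg x)"
      by unfold_locales (auto simp: sg_def symmetric_conv)
    interpret S: graph "sg x" by fact
    have "subgraph (sg x) T"
      using x S.wf_digraph wf_digraph by (auto simp: subgraph_def sg_def compatible_def)
    moreover have "Digraph_Component.connected (sg x)"
      using S.reachable_mk_symmetric_eq[OF S.sym_arcs] S.reachable_refl
      by (auto simp: Digraph_Component.connected_def strongly_connected_def sg_def)
    ultimately show ?thesis using g by (simp add: subtrees_def) (simp add: sg_def)
  qed
  moreover have "H \<in> sg ` verts T" if H: "H \<in> subtrees T" "card (verts H) = 1" for H
  proof -
    from H(1) have "graph H" "subgraph H T" by (auto simp: subtrees_def)
    interpret H: graph H by fact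
    from H(2) obtain x where x: "verts H = {x}" by (auto simp: card_1_singleton_iff)
    have "arcs H = {}"
      using H.no_loops H.tail_in_verts H.head_in_verts x by fastforce
    then have "H = sg x"
      using x \<open>subgraph H T\<close>
      by (intro pre_digraph.equality) (auto simp: sg_def subgraph_def compatible_def)
    then show ?thesis using x \<open>subgraph H T\<close> by (auto simp: subgraph_def)
  qed
  ultimately have "bij_betw sg (verts T) {H \<in> subtrees T. card (verts H) = 1}"
    by (intro bij_betw_imageI) (auto simp: inj_on_def sg_def)
  then show ?thesis unfolding num_subtrees_def by (simp add: bij_betw_same_card)
qed

lemma subtree_polynomial_root_bound:
  fixes z :: complex and s :: "nat \<Rightarrow> nat"
  assumes root: "(\<Sum>k = 1..n. of_nat (s k) * z ^ k) = 0" and "z \<noteq> 0" and "n \<ge> 1"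
    and s1: "s 1 = n" and s: "\<And>k. k \<ge> 2 \<Longrightarrow> s k \<le> (n - 1) choose (k - 1)"
  shows "real n + 1 \<le> (1 + norm z) ^ (n - 1)"
proof -
  let ?r = "norm z"
  obtain m where n: "n = Suc m" using \<open>n \<ge> 1\<close> by (cases n) auto
  have "(\<Sum>k = 1..n. of_nat (s k) * z ^ k) = z * (\<Sum>j\<le>m. of_nat (s (Suc j)) * z ^ j)"
    unfolding n One_nat_def sum.atLeast_Suc_atMost_Suc_shift
    by (simp add: sum_distrib_left atMost_atLeast0 algebra_simps)
  with root \<open>z \<noteq> 0\<close> have "(\<Sum>j\<le>m. of_nat (s (Suc j)) * z ^ j) = 0" by simp
  then have "of_nat n + (\<Sum>j=1..m. of_nat (s (Suc j)) * z ^ j) = 0"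
    using s1 by (simp add: atMost_atLeast0 sum.atLeast_Suc_atMost)
  then have "norm (of_nat n :: complex) = norm (\<Sum>j=1..m. of_nat (s (Suc j)) * z ^ j)"
    by (metis add_eq_0_iff norm_minus_cancel)
  then have "real n = norm (\<Sum>j=1..m. of_nat (s (Suc j)) * z ^ j)" by simp
  also have "\<dots> \<le> (\<Sum>j=1..m. real (s (Suc j)) * ?r ^ j)"
    by (rule order_trans[OF norm_sum]) (simp add: norm_mult norm_power)
  also have "\<dots> \<le> (\<Sum>j=1..m. real (m choose j) * ?r ^ j)"
  proof (intro sum_mono mult_right_mono)
    fix j assume "j \<in> {1..m}"
    then show "real (s (Suc j)) \<le> real (m choose j)"
      using s[of "Suc j"] n by simp
  qed simp
  also have "\<dots> = (1 + ?r) ^ m - 1"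
    using binomial_ring[of ?r 1 m]
    by (simp add: add.commute atMost_atLeast0 sum.atLeast_Suc_atMost)
  finally show ?thesis by (simp add: n)
qed

theorem theorem4p2:
  fixes T :: "('a, 'b) pre_digraph" and n :: nat and z :: complex
  assumes "undirected_tree T"
    and "card (verts T) = n" and "n \<ge> 2"
    and "z \<in> subtree_roots T" and "z \<noteq> 0"
  shows "norm z > root (n - 1) (real n - 1) - 1"
proof -
  obtain v where v: "v \<in> verts T" using assms(2,3) by fastforce
  have "graph T" using assms(1) by (simp add: undirected_tree_def)
  interpret graph T by fact
  interpret rooted_tree T v by unfold_locales (use assms(1) v in auto)
  have "(\<Sum>k = 1..n. of_nat (num_subtrees T k) * z ^ k) = 0"
    using assms(2,4) by (simp add: subtree_roots_def subtree_poly_def poly_sum poly_monom)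
  then have "real n + 1 \<le> (1 + norm z) ^ (n - 1)"
    using assms num_subtrees_1[OF \<open>graph T\<close>] num_subtrees_le
    by (intro subtree_polynomial_root_bound[where s = "num_subtrees T"]) auto
  then have "real n - 1 < (1 + norm z) ^ (n - 1)" by simp
  then have "root (n - 1) (real n - 1) < root (n - 1) ((1 + norm z) ^ (n - 1))"
    using assms(3) by (intro real_root_less_mono) auto
  also have "\<dots> = 1 + norm z"
    using assms(3) by (intro real_root_power_cancel) auto
  finally show ?thesis by simp
qed

end
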